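(* Let $a\ge 3$ and $m$ be integers with $\frac{2a}{3}+1\leq m\leq a$, and let $R_2(m,a)$ denote the 2-color Rado number of $x_1+\cdots+x_{m-1}=ax_m$. Then for $a=3$ we have $R_2(a,a)=9$, and for $a\geq 4$ we have $R_2(m,a)=3$ if $a\equiv m-1\pmod 2$ and $R_2(m,a)=4$ if $a\not\equiv m-1\pmod 2$.
   Context: The 2-color Rado number $R_2(m,a)$ of $x_1+\cdots+x_{m-1}=ax_m$ is the least positive integer $n$ such that for every coloring of $[n]=\{1,\dots,n\}$ with two colors there exist $x_1,\dots,x_m\in[n]$ (not necessarily distinct), all of the same color, satisfying the equation. *)

theory Defs
  imports Complex_Main "HOL-Library.Extended_Nat" "HOL-Number_Theory.Cong"
begin

text \<open>
  A 2-coloring of \<open>{1..n}\<close> is given by a total function \<open>c :: nat \<Rightarrow> bool\<close>, whose values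
  outside \<open>{1..n}\<close> are never inspected. The solution \<open>(x\<^sub>1, \<dots>, x\<^sub>m)\<close> is a function on
  indices whose values outside \<open>{1..m}\<close> are irrelevant (for \<open>m \<ge> 1\<close>).
\<close>

definition mono_solution :: "nat \<Rightarrow> nat \<Rightarrow> nat \<Rightarrow> (nat \<Rightarrow> bool) \<Rightarrow> (nat \<Rightarrow> nat) \<Rightarrow> bool" where
  "mono_solution m a n c x \<longleftrightarrow>
     (\<forall>i\<in>{1..m}. x i \<in> {1..n}) \<and>
     (\<exists>k. \<forall>i\<in>{1..m}. c (x i) = k) \<and>
     (\<Sum>i=1..m-1. x i) = a * x m"

definition rado_property2 :: "nat \<Rightarrow> nat \<Rightarrow> nat \<Rightarrow> bool" where
  "rado_property2 m a n \<longleftrightarrow> (\<forall>c :: nat \<Rightarrow> bool. \<exists>x. mono_solution m a n c x)"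

text \<open>
  The value is \<open>\<infinity>\<close> if no suitable \<open>n\<close> exists, so that an equation \<open>rado_number2 m a = N\<close>
  with finite \<open>N\<close> asserts both that such an \<open>n\<close> exists and that \<open>N\<close> is the least one.
\<close>

definition rado_number2 :: "nat \<Rightarrow> nat \<Rightarrow> enat" where
  "rado_number2 m a = Inf {enat n | n. n > 0 \<and> rado_property2 m a n}"

end

theory Submission
  imports Defs
begin

text \<open>
  Write \<open>M = m - 1\<close> for the number of summands. Since \<open>2 * a \<le> 3 * M\<close> and \<open>M < a\<close>, each of the
  pairs \<open>{1, 2}\<close> and \<open>{2, 3}\<close> contains a solution with right-hand side \<open>a\<close> and \<open>2 * a\<close>
  respectively, so a solution-free coloring of \<open>{1..3}\<close> must separate \<open>2\<close> from \<open>1\<close> and \<open>3\<close>. That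
  coloring is solution-free exactly when \<open>a\<close> and \<open>M\<close> differ in parity; the color of \<open>4\<close> then
  completes a solution within \<open>{2, 4}\<close> or within \<open>{1, 3, 4}\<close>. For \<open>a = m = 3\<close> the coloring is
  forced from \<open>1\<close> up to \<open>8\<close>, and fails at \<open>9\<close>.
\<close>

lemma rado_property2_mono:
  assumes "rado_property2 m a n" and "n \<le> n'"
  shows "rado_property2 m a n'"
proof -
  have "{1..n} \<subseteq> {1..n'}" using assms(2) by auto
  then have "mono_solution m a n' c x" if "mono_solution m a n c x" for c x
    using that unfolding mono_solution_def by blast
  then show ?thesis using assms(1) unfolding rado_property2_def by blast
qed

text \<open>Since the property passes to larger bounds, failure at \<open>n\<close> excludes every
  smaller candidate as well.\<close>

lemma rado_number2_eqI:
  assumes "rado_property2 m a (Suc n)" and "\<not> rado_property2 m a n"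
  shows "rado_number2 m a = enat (Suc n)"
  unfolding rado_number2_def
proof (rule antisym)
  show "Inf {enat k |k. 0 < k \<and> rado_property2 m a k} \<le> enat (Suc n)"
    using assms(1) by (intro Inf_lower) blast
  show "enat (Suc n) \<le> Inf {enat k |k. 0 < k \<and> rado_property2 m a k}"
    using assms(2) rado_property2_mono
    by (intro Inf_greatest) (auto simp: not_less_eq_eq[symmetric])
qed

lemma sum_three_blocks:
  fixes u v w :: nat
  shows "(\<Sum>i=1..p+q+r. if i \<le> p then u else if i \<le> p + q then v else w) = p*u + q*v + r*w"
proof (induction r)
  case 0
  show ?case
  proof (induction q)
    case 0
    show ?case by simp
  next
    case (Suc q)
    have "(\<Sum>i=1..p+q. if i \<le> p then u else if i \<le> p + Suc q then v else w)
        = (\<Sum>i=1..p+q. if i \<le> p then u else if i \<le> p + q then v else w)"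
      by (intro sum.cong) auto
    with Suc show ?case by simp
  qed
qed simp

text \<open>Every solution below is built from constant blocks. An empty block still needs a value
  of the right range and color, hence padding such as \<open>0 * 1\<close>.\<close>

lemma mono_solution_three_values:
  assumes "m = Suc (p + q + r)" and "p*u + q*v + r*w = a*z"
    and "{u, v, w, z} \<subseteq> {1..n}" and "c u = c z" "c v = c z" "c w = c z"
  shows "\<exists>x. mono_solution m a n c x"
proof
  let ?y = "\<lambda>i. if i \<le> p then u else if i \<le> p + q then v else w"
  have "(\<Sum>i=1..m-1. (?y(m := z)) i) = (\<Sum>i=1..p+q+r. ?y i)"
    using assms(1) by (intro sum.cong) auto
  then have "(\<Sum>i=1..m-1. (?y(m := z)) i) = a * z"
    by (simp only: sum_three_blocks assms(2))
  then show "mono_solution m a n c (?y(m := z))"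
    unfolding mono_solution_def using assms(3-) by auto
qed

text \<open>With \<open>M = m - 1\<close>, take \<open>a - M\<close> twos and \<open>2*M - a\<close>
  ones: \<open>M\<close> terms with sum \<open>a\<close>. The bound gives
  \<open>a \<le> 2*M\<close>, so nothing truncates.\<close>

lemma colors_1_2_differ:
  assumes "2*a + 3 \<le> 3*m" "m \<le> a" and "2 \<le> n" and "\<nexists>x. mono_solution m a n c x"
  shows "c 2 \<noteq> c 1"
proof
  assume "c 2 = c 1"
  moreover from assms(1,2) have sum: "m = Suc ((a - (m - 1)) + (2*(m - 1) - a) + 0)"
    "(a - (m - 1)) * 2 + (2*(m - 1) - a) * 1 + 0 * 1 = a * 1"
    by linarith+
  ultimately show False
    using mono_solution_three_values[OF sum, of n c] assms(3,4)
    by auto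
qed

text \<open>Here \<open>2*(a - M)\<close> threes and \<open>3*M - 2*a\<close> twos sum to
  \<open>2*a\<close>; the bound says exactly that the second count does not truncate.\<close>

lemma colors_2_3_differ:
  assumes "2*a + 3 \<le> 3*m" "m \<le> a" and "3 \<le> n" and "\<nexists>x. mono_solution m a n c x"
  shows "c 3 \<noteq> c 2"
proof
  assume "c 3 = c 2"
  moreover from assms(1,2) have sum: "m = Suc (2*(a - (m - 1)) + (3*(m - 1) - 2*a) + 0)"
    "2*(a - (m - 1)) * 3 + (3*(m - 1) - 2*a) * 2 + 0 * 2 = a * 2"
    by linarith+
  ultimately show False
    using mono_solution_three_values[OF sum, of n c] assms(3,4)
    by auto
qed

text \<open>Separating 1 from 2 makes every monochromatic solution constant, which forces
  \<open>m - 1 = a\<close>.\<close>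

lemma not_rado_property2_two:
  assumes "2 \<le> m" "m \<le> a"
  shows "\<not> rado_property2 m a 2"
proof
  assume "rado_property2 m a 2"
  then obtain x where x: "mono_solution m a 2 (\<lambda>i. i = 1) x"
    unfolding rado_property2_def by blast
  have "x i = x m" if "i \<in> {1..m-1}" for i
  proof -
    have "i \<in> {1..m}" "m \<in> {1..m}" using that assms by auto
    then have "x i \<in> {1..2}" "x m \<in> {1..2}" "(x i = 1) = (x m = 1)"
      using x unfolding mono_solution_def by blast+
    then show ?thesis by auto
  qed
  then have "(\<Sum>i=1..m-1. x i) = (m - 1) * x m" by simp
  moreover have "x m \<in> {1..2}" "(\<Sum>i=1..m-1. x i) = a * x m"
    using x assms(1) unfolding mono_solution_def by simp_all
  ultimately show False using assms by simp
qed

lemma rado_property2_three: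
  assumes "2*a + 3 \<le> 3*m" "m \<le> a" and "even (a - (m - 1))"
  shows "rado_property2 m a 3"
  unfolding rado_property2_def
proof (rule allI, rule ccontr)
  fix c :: "nat \<Rightarrow> bool"
  assume none: "\<nexists>x. mono_solution m a 3 c x"
  from assms(3) obtain t where t: "a - (m - 1) = 2 * t" by (elim evenE)
  have "c 3 = c 1"
    using colors_1_2_differ[OF assms(1,2) _ none] colors_2_3_differ[OF assms(1,2) _ none] by auto
  \<comment> \<open>Each one replaced by a three adds 2, so \<open>t\<close> threes lift the sum
    from \<open>m - 1\<close> to \<open>a\<close>.\<close>
  moreover have sum: "m = Suc (t + (m - 1 - t) + 0)" "t * 3 + (m - 1 - t) * 1 + 0 * 1 = a * 1"
    using assms(1,2) t by linarith+
  ultimately show False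
    using mono_solution_three_values[OF sum, of 3 c] none by auto
qed

text \<open>Color by parity. Among odd values the two sides have the parities of
  \<open>m - 1\<close> and \<open>a\<close>; the only even value is 2, and a constant solution
  forces \<open>m - 1 = a\<close>.\<close>

lemma not_rado_property2_three:
  assumes "2 \<le> m" "m \<le> a" and "odd (a - (m - 1))"
  shows "\<not> rado_property2 m a 3"
proof
  assume "rado_property2 m a 3"
  then obtain x where x: "mono_solution m a 3 odd x"
    unfolding rado_property2_def by blast
  have sum: "(\<Sum>i=1..m-1. x i) = a * x m"
    using x unfolding mono_solution_def by blast
  have range: "x i \<in> {1..3}" and parity: "odd (x i) = odd (x m)" if "i \<in> {1..m}" for i
  proof -
    have "m \<in> {1..m}" using assms by simp
    then show "x i \<in> {1..3}" "odd (x i) = odd (x m)"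
      using x that unfolding mono_solution_def by blast+
  qed
  show False
  proof (cases "odd (x m)")
    case True
    have "{i \<in> {1..m-1}. odd (x i)} = {1..m-1}" using parity True by auto
    then have "odd (\<Sum>i=1..m-1. x i) = odd (m - 1)" by (simp add: even_sum_iff)
    then show False using sum True assms by simp
  next
    case False
    have two: "x i = 2" if "i \<in> {1..m}" for i
    proof -
      have "even (x i)" using parity[OF that] False by simp
      moreover have "x i = 1 \<or> x i = 2 \<or> x i = 3" using range[OF that] by auto
      ultimately show ?thesis by auto
    qed
    then have "(\<Sum>i=1..m-1. x i) = (\<Sum>i=1..m-1. 2)"
      by (intro sum.cong refl) auto
    moreover have "x m = 2" using two assms(1) by auto
    ultimately show False using sum assms by simp
  qed
qed

lemma rado_property2_four:
  assumes "2*a + 3 \<le> 3*m" "m \<le> a" "4 \<le> a" and "odd (a - (m - 1))"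
  shows "rado_property2 m a 4"
  unfolding rado_property2_def
proof (rule allI, rule ccontr)
  fix c :: "nat \<Rightarrow> bool"
  assume none: "\<nexists>x. mono_solution m a 4 c x"
  have c: "c 2 \<noteq> c 1" "c 3 = c 1"
    using colors_1_2_differ[OF assms(1,2) _ none] colors_2_3_differ[OF assms(1,2) _ none] by auto
  from assms(4) obtain t where t: "a - (m - 1) = 2 * t + 1" by (elim oddE)
  consider "c 4 = c 2" | "c 4 = c 1" "t = 0" | "c 4 = c 1" "t \<noteq> 0" using c by auto
  then show False
  proof cases
    case 1
    \<comment> \<open>This is the solution in {1, 2} doubled.\<close>
    have sum: "m = Suc ((a - (m - 1)) + (2*(m - 1) - a) + 0)"
      "(a - (m - 1)) * 4 + (2*(m - 1) - a) * 2 + 0 * 2 = a * 2"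
      using assms(1,2) by linarith+
    with 1 show False
      using mono_solution_three_values[OF sum, of 4 c] none
      by auto
  next
    case 2
    \<comment> \<open>Here \<open>m = a\<close>, so \<open>4 \<le> a\<close> leaves room for three
      fours.\<close>
    have sum: "m = Suc (3 + (m - 4) + 0)" "3 * 4 + (m - 4) * 3 + 0 * 3 = a * 3"
      using assms(1,2,3) t 2 by linarith+
    with 2 show False
      using mono_solution_three_values[OF sum, of 4 c] none c by auto
  next
    case 3
    \<comment> \<open>Relative to all ones, the four adds 3 and each three adds 2, in total
      \<open>2 * t + 1\<close>.\<close>
    have sum: "m = Suc (1 + (t - 1) + (m - 1 - t))"
      "1 * 4 + (t - 1) * 3 + (m - 1 - t) * 1 = a * 1"
      using assms(1,2,3) t 3 by linarith+
    with 3 show False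
      using mono_solution_three_values[OF sum, of 4 c] none c by auto
  qed
qed

lemma rado_property2_3_3_iff:
  "rado_property2 3 3 n \<longleftrightarrow>
    (\<forall>c :: nat \<Rightarrow> bool. \<exists>x\<in>{1..n}. \<exists>y\<in>{1..n}. \<exists>z\<in>{1..n}. c x = c z \<and> c y = c z \<and> x + y = 3 * z)"
  (is "_ \<longleftrightarrow> (\<forall>c. ?sol c)")
proof -
  have "(\<exists>x. mono_solution 3 3 n c x) \<longleftrightarrow> ?sol c" for c
  proof
    assume "\<exists>x. mono_solution 3 3 n c x"
    then obtain x where x: "mono_solution 3 3 n c x" ..
    have "{1..3} = {1, 2, 3::nat}" "{1..3 - 1} = {1, 2::nat}" by auto
    with x have "x 1 \<in> {1..n}" "x 2 \<in> {1..n}" "x 3 \<in> {1..n}"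
      "c (x 1) = c (x 3)" "c (x 2) = c (x 3)" "x 1 + x 2 = 3 * x 3"
      unfolding mono_solution_def by auto
    then show "?sol c" by blast
  next
    assume "?sol c"
    then obtain x y z where "x \<in> {1..n}" "y \<in> {1..n}" "z \<in> {1..n}"
      "c x = c z" "c y = c z" "x + y = 3 * z" by blast
    then show "\<exists>x. mono_solution 3 3 n c x"
      by (intro mono_solution_three_values[of 3 1 1 0 x y z 3 z n c]) auto
  qed
  then show ?thesis unfolding rado_property2_def by simp
qed

lemma rado_property2_3_3_nine: "rado_property2 3 3 9"
  unfolding rado_property2_3_3_iff
proof (rule allI, rule ccontr)
  fix c :: "nat \<Rightarrow> bool"
  assume none: "\<not> (\<exists>x\<in>{1..9}. \<exists>y\<in>{1..9}. \<exists>z\<in>{1..9}. c x = c z \<and> c y = c z \<and> x + y = 3 * z)"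
  have no: "\<not> (c x = c z \<and> c y = c z)"
    if "x + y = 3 * z" "x \<in> {1..9}" "y \<in> {1..9}" "z \<in> {1..9}" for x y z
    using none that by blast
  show False
    \<comment> \<open>In this order the triples give 3 and 4 the color of 1, and 2, 8, 6, 5 the
      other one. Then 6 + 9 = 3 * 5 puts 9 with 1, against 3 + 9 = 3 * 4.\<close>
    using no[of 1 2 1] no[of 3 3 2] no[of 2 4 2] no[of 1 8 3] no[of 3 6 3] no[of 4 5 3]
      no[of 7 8 5] no[of 6 9 5] no[of 3 9 4]
    by auto
qed

lemma not_rado_property2_3_3_eight: "\<not> rado_property2 3 3 8"
proof -
  \<comment> \<open>Up to swapping colors, this is the coloring of 1 to 8 that the preceding triples
    force.\<close>
  let ?c = "\<lambda>i. i \<in> {1, 3, 4, 7::nat}"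
  have range: "{1..8} = {1, 2, 3, 4, 5, 6, 7, 8::nat}" by auto
  \<comment> \<open>Solving for the second summand leaves two variables; a truncated difference is 0
    and thus out of range.\<close>
  have "\<forall>z\<in>{1..8}. \<forall>x\<in>{1..8}.
      3 * z - x \<in> {1..8} \<and> ?c x = ?c z \<longrightarrow> ?c (3 * z - x) \<noteq> ?c z"
    unfolding range by simp
  then have "\<not> (\<exists>x\<in>{1..8}. \<exists>y\<in>{1..8}. \<exists>z\<in>{1..8}. ?c x = ?c z \<and> ?c y = ?c z \<and> x + y = 3 * z)"
    by (metis add_diff_cancel_left')
  then show ?thesis unfolding rado_property2_3_3_iff not_all by (rule exI[of _ ?c])
qed

theorem theorem4:
  fixes a m :: nat
  assumes "a \<ge> 3"
    and "2 * real a / 3 + 1 \<le> real m"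
    and "m \<le> a"
  shows "(a = 3 \<longrightarrow> rado_number2 a a = 9) \<and>
         (a \<ge> 4 \<longrightarrow>
            ([int a = int m - 1] (mod 2) \<longrightarrow> rado_number2 m a = 3) \<and>
            (\<not> [int a = int m - 1] (mod 2) \<longrightarrow> rado_number2 m a = 4))"
proof -
  have bound: "2*a + 3 \<le> 3*m" using assms(2) by simp
  then have m: "2 \<le> m" using assms(1) by linarith
  have "int (a - (m - 1)) = int a - (int m - 1)" using m assms(3) by simp
  then have parity: "[int a = int m - 1] (mod 2) \<longleftrightarrow> even (a - (m - 1))"
    by (metis cong_iff_dvd_diff even_of_nat)
  show ?thesis
    using rado_number2_eqI[of 3 3 8] rado_property2_3_3_nine not_rado_property2_3_3_eight
      rado_number2_eqI[of m a 2] not_rado_property2_two[OF m assms(3)]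
      rado_property2_three[OF bound assms(3)]
      rado_number2_eqI[of m a 3] not_rado_property2_three[OF m assms(3)]
      rado_property2_four[OF bound assms(3)]
    unfolding parity by (auto simp: numeral_eq_enat)
qed

end
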